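(* For every $K_5$-free finite simple graph $G$ on $n$ vertices, $\tau_{B}(G) \le \frac{29 n^2}{200}$.
   Context: All graphs are finite, simple and undirected. $\tau_{B}(G)$ denotes the minimum size of a set of edges whose deletion from $G$ leaves a bipartite graph. $K_5$-free means $G$ contains no complete subgraph on $5$ vertices. *)

theory Defs
  imports Complex_Main "HOL-Library.Ramsey"
begin

text \<open>A finite simple graph is a vertex set \<open>V\<close> with a set \<open>E\<close> of
  two-element subsets of \<open>V\<close>.\<close>

definition finite_simple_graph :: "'a set \<Rightarrow> 'a set set \<Rightarrow> bool" where
  "finite_simple_graph V E \<longleftrightarrow> finite V \<and> E \<subseteq> nsets V 2"

definition K_free :: "nat \<Rightarrow> 'a set \<Rightarrow> 'a set set \<Rightarrow> bool" where
  "K_free r V E \<longleftrightarrow> \<not> (\<exists>S \<subseteq> V. finite S \<and> card S = r \<and> clique S E)"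

definition bipartite_graph :: "'a set \<Rightarrow> 'a set set \<Rightarrow> bool" where
  "bipartite_graph V E \<longleftrightarrow>
     (\<exists>X Y. X \<union> Y = V \<and> X \<inter> Y = {} \<and> (\<forall>e\<in>E. \<exists>x\<in>X. \<exists>y\<in>Y. e = {x, y}))"

definition tau_B :: "'a set \<Rightarrow> 'a set set \<Rightarrow> nat" where
  "tau_B V E = Min {card F | F. F \<subseteq> E \<and> bipartite_graph V (E - F)}"

text \<open>For a finite simple graph the minimum is over a finite set that contains
  \<open>card E\<close>, so it is attained.\<close>

lemma tau_B_attained:
  assumes "finite_simple_graph V E"
  shows "\<exists>F \<subseteq> E. bipartite_graph V (E - F) \<and> card F = tau_B V E"
    and "\<And>F. F \<subseteq> E \<Longrightarrow> bipartite_graph V (E - F) \<Longrightarrow> tau_B V E \<le> card F"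
proof -
  let ?C = "{card F | F. F \<subseteq> E \<and> bipartite_graph V (E - F)}"
  have "finite E"
    using assms unfolding finite_simple_graph_def
    by (meson finite_imp_finite_nsets finite_subset)
  then have fin: "finite ?C"
    by simp
  have "bipartite_graph V (E - E)"
    unfolding bipartite_graph_def by auto
  then have "?C \<noteq> {}"
    by blast
  from Min_in[OF fin this]
  show "\<exists>F \<subseteq> E. bipartite_graph V (E - F) \<and> card F = tau_B V E"
    unfolding tau_B_def by auto
  show "tau_B V E \<le> card F" if "F \<subseteq> E" "bipartite_graph V (E - F)" for F
    unfolding tau_B_def by (rule Min_le[OF fin]) (use that in blast)
qed

end

theory Submission
  imports Defs "HOL-Analysis.Convex"
begin

text \<open>
  Choose a vertex \<open>x\<close>, make its non-neighbours one colour class and colour its neighbourhood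
  recursively. Averaging over all \<open>x\<close> instead of taking one of maximum degree, as in Fueredi's
  proof of stability for Turan's theorem, shows that a \<open>K\<^sub>5\<close>-free graph with \<open>e\<close> edges has a
  4-colouring with at most \<open>e - 8e\<^sup>2/(3n\<^sup>2)\<close> monochromatic edges. The best of the three ways to
  merge the colours into two pairs loses at most a third of the other edges, so
  \<open>\<tau>\<^sub>B \<le> e - 16e\<^sup>2/(9n\<^sup>2) \<le> 9n\<^sup>2/64\<close>, which is smaller than \<open>29n\<^sup>2/200\<close>.
\<close>

section \<open>Ordered-pair edge counts and extension of a colouring by one class\<close>

text \<open>Both sums below run over ordered pairs, so within one set every edge counts twice.\<close>

definition edge_sum :: "'a set set \<Rightarrow> 'a set \<Rightarrow> 'a set \<Rightarrow> real" where
  "edge_sum E A B = (\<Sum>u\<in>A. \<Sum>v\<in>B. of_bool ({u, v} \<in> E))"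

definition mono_sum :: "'a set set \<Rightarrow> ('a \<Rightarrow> 'b) \<Rightarrow> 'a set \<Rightarrow> real" where
  "mono_sum E c A = (\<Sum>u\<in>A. \<Sum>v\<in>A. of_bool ({u, v} \<in> E \<and> c u = c v))"

lemma mono_sum_le_edge_sum: "mono_sum E c A \<le> edge_sum E A A"
  unfolding mono_sum_def edge_sum_def by (intro sum_mono) auto

lemma edge_sum_commute: "edge_sum E A B = edge_sum E B A"
  unfolding edge_sum_def by (subst sum.swap) (simp add: insert_commute)

lemma edge_sum_Un_left:
  assumes "finite A" "finite B" "A \<inter> B = {}"
  shows "edge_sum E (A \<union> B) C = edge_sum E A C + edge_sum E B C"
  unfolding edge_sum_def using assms by (rule sum.union_disjoint)

lemma edge_sum_Un_right:
  assumes "finite A" "finite B" "A \<inter> B = {}"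
  shows "edge_sum E C (A \<union> B) = edge_sum E C A + edge_sum E C B"
  using edge_sum_Un_left[OF assms] by (simp add: edge_sum_commute[of E C])

lemma edge_sum_singleton:
  assumes "finite W"
  shows "edge_sum E {v} W = card {u \<in> W. {v, u} \<in> E}"
proof -
  have "W \<inter> {u. {v, u} \<in> E} = {u \<in> W. {v, u} \<in> E}" by auto
  then show ?thesis
    using assms by (simp add: edge_sum_def of_bool_def sum.If_cases)
qed

lemma edge_sum_conv_singletons: "edge_sum E A B = (\<Sum>u\<in>A. edge_sum E {u} B)"
  by (simp add: edge_sum_def)

text \<open>Since \<open>k\<close> is a fresh colour on \<open>N\<close>, no edge between
  \<open>N\<close> and \<open>Z\<close> becomes monochromatic, while every edge inside
  \<open>Z\<close> does.\<close>

lemma mono_sum_extend: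
  assumes "finite N" "finite Z" "N \<inter> Z = {}" and "\<And>v. v \<in> N \<Longrightarrow> g v \<noteq> k"
  defines "c \<equiv> (\<lambda>v. if v \<in> N then g v else k)"
  shows "mono_sum E c (N \<union> Z) = mono_sum E g N + edge_sum E Z Z"
proof -
  have "(\<Sum>v\<in>N \<union> Z. of_bool ({u, v} \<in> E \<and> c u = c v)) =
      (\<Sum>v\<in>N. of_bool ({u, v} \<in> E \<and> g u = g v) :: real)" if "u \<in> N" for u
    using assms that by (intro sum.mono_neutral_cong_right) (auto simp: c_def)
  moreover have "(\<Sum>v\<in>N \<union> Z. of_bool ({u, v} \<in> E \<and> c u = c v)) =
      (\<Sum>v\<in>Z. of_bool ({u, v} \<in> E) :: real)" if "u \<in> Z" for u
  proof -
    have "u \<notin> N" using that assms(3) by auto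
    then show ?thesis
      using assms by (intro sum.mono_neutral_cong_right) (auto simp: c_def dest: sym)
  qed
  ultimately show ?thesis
    unfolding mono_sum_def edge_sum_def using assms(1-3) by (simp add: sum.union_disjoint)
qed

section \<open>Clique-free neighbourhoods\<close>

lemma K_free_neighbours:
  assumes "K_free (Suc r) W E" "\<And>u. {u} \<notin> E" "x \<in> W"
  shows "K_free r {v \<in> W. {x, v} \<in> E} E"
  unfolding K_free_def
proof safe
  fix S assume S: "S \<subseteq> {v \<in> W. {x, v} \<in> E}" "finite S" "clique S E" "r = card S"
  \<comment> \<open>Without loops \<open>x\<close> is not its own neighbour, so adding it to
    \<open>S\<close> gives a strictly larger clique.\<close>
  have "x \<notin> S" using S(1) assms(2)[of x] by auto
  then have "card (insert x S) = Suc r" using S by simp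
  moreover have "clique (insert x S) E"
    using S(1,3) by (auto simp: clique_def insert_commute)
  ultimately show False
    using assms(1,3) S(1,2) unfolding K_free_def by blast
qed

lemma K_free_2_edge_sum:
  assumes "K_free 2 W E" "\<And>u. {u} \<notin> E"
  shows "edge_sum E W W = 0"
proof -
  have "{u, v} \<notin> E" if "u \<in> W" "v \<in> W" for u v
  proof
    assume uv: "{u, v} \<in> E"
    with assms(2) have "u \<noteq> v" by auto
    then have "card {u, v} = 2" "clique {u, v} E"
      using uv by (auto simp: clique_def insert_commute)
    with that have "\<exists>S\<subseteq>W. finite S \<and> card S = 2 \<and> clique S E"
      by (intro exI[of _ "{u, v}"]) simp
    with assms(1) show False
      unfolding K_free_def by contradiction
  qed
  then show ?thesis by (simp add: edge_sum_def)
qed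

section \<open>Averaging over the starting vertex\<close>

lemma exists_le_average:
  fixes f :: "'a \<Rightarrow> real"
  assumes "finite W" "W \<noteq> {}" "(\<Sum>x\<in>W. f x) \<le> B"
  shows "\<exists>x\<in>W. card W * f x \<le> B"
proof (rule ccontr)
  assume "\<not> ?thesis"
  then have "(\<Sum>x\<in>W. B) < (\<Sum>x\<in>W. card W * f x)"
    using assms(1,2) by (intro sum_strict_mono) auto
  also have "\<dots> = card W * (\<Sum>x\<in>W. f x)" by (simp add: sum_distrib_left)
  also have "\<dots> \<le> card W * B" using assms(3) by (intro mult_left_mono) auto
  finally show False by simp
qed

text \<open>The averaging step: the recursive colouring \<open>g x\<close> of the neighbourhood of \<open>x\<close> only needs to
  satisfy the bound that is uniform in the number of edges.\<close>

lemma coloring_step: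
  fixes E :: "'a set set" and W :: "'a set" and k :: nat and g :: "'a \<Rightarrow> 'a \<Rightarrow> nat"
  defines "N \<equiv> (\<lambda>x. {v \<in> W. {x, v} \<in> E})"
  assumes W: "finite W" "W \<noteq> {}"
    and g: "\<And>x v. x \<in> W \<Longrightarrow> v \<in> N x \<Longrightarrow> g x v \<le> k"
    and gb: "\<And>x. x \<in> W \<Longrightarrow>
      (real k + 1) * (edge_sum E (N x) (N x) + mono_sum E (g x) (N x)) \<le> k * (real (card (N x)))\<^sup>2"
  shows "\<exists>c. c ` W \<subseteq> {..Suc k} \<and>
    (real k + 1) * (card W)\<^sup>2 * mono_sum E c W + (real k + 2) * (edge_sum E W W)\<^sup>2
      \<le> (real k + 1) * (card W)\<^sup>2 * edge_sum E W W"
proof -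
  define m where "m = real (card W)"
  define M where "M = edge_sum E W W"
  define d where "d = (\<lambda>x. real (card (N x)))"
  define c where "c = (\<lambda>x v. if v \<in> N x then g x v else Suc k)"
  have d: "d x = edge_sum E {x} W" for x
    using W(1) by (simp add: d_def N_def edge_sum_singleton)
  have sum_d: "(\<Sum>x\<in>W. d x) = M"
    unfolding M_def d by (rule edge_sum_conv_singletons[symmetric])
  \<comment> \<open>Adding \<open>M\<close> completes the count: the edges inside \<open>Z\<close>
    and from \<open>Z\<close> to \<open>N x\<close> combine to twice the degree sum over
    \<open>Z\<close>, and what remains is exactly the quantity bounded by \<open>gb\<close>.\<close>
  have bound: "(real k + 1) * (M + mono_sum E (c x) W)
      \<le> (real k + 1) * (2 * edge_sum E (W - N x) W) + k * (d x)\<^sup>2" if x: "x \<in> W" for x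
  proof -
    define Z where "Z = W - N x"
    have WZ: "W = N x \<union> Z" "finite (N x)" "finite Z" "N x \<inter> Z = {}"
      using W by (auto simp: Z_def N_def)
    have "mono_sum E (c x) W = mono_sum E (g x) (N x) + edge_sum E Z Z"
      unfolding c_def by (subst WZ(1), rule mono_sum_extend) (use WZ g[OF x] in force)+
    moreover have "M = edge_sum E (N x) (N x) + 2 * edge_sum E Z (N x) + edge_sum E Z Z"
      unfolding M_def using WZ
      by (simp add: edge_sum_Un_left edge_sum_Un_right edge_sum_commute[of E "N x" Z])
    moreover have "edge_sum E Z W = edge_sum E Z (N x) + edge_sum E Z Z"
      using WZ by (simp add: edge_sum_Un_right)
    ultimately have "M + mono_sum E (c x) W = 2 * edge_sum E Z W
        + (edge_sum E (N x) (N x) + mono_sum E (g x) (N x))"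
      by simp
    with gb[OF x] show ?thesis
      by (simp add: Z_def d_def algebra_simps)
  qed
  \<comment> \<open>Double counting: the degree \<open>d v\<close> occurs once for each
    \<open>x\<close> not adjacent to \<open>v\<close>, hence \<open>m - d v\<close> times.\<close>
  have "(\<Sum>x\<in>W. edge_sum E (W - N x) W) = (\<Sum>x\<in>W. \<Sum>v\<in>W. of_bool ({x, v} \<notin> E) * d v)"
  proof (rule sum.cong[OF refl])
    fix x assume "x \<in> W"
    have "edge_sum E (W - N x) W = (\<Sum>v\<in>W - N x. d v)"
      unfolding d by (rule edge_sum_conv_singletons)
    also have "\<dots> = (\<Sum>v\<in>W. of_bool ({x, v} \<notin> E) * d v)"
      using W(1) by (intro sum.mono_neutral_cong_left) (auto simp: N_def)
    finally show "edge_sum E (W - N x) W = \<dots>" .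
  qed
  also have "\<dots> = (\<Sum>v\<in>W. (m - d v) * d v)"
  proof (subst sum.swap, rule sum.cong[OF refl])
    fix v assume "v \<in> W"
    have "(\<Sum>x\<in>W. of_bool ({x, v} \<notin> E) :: real) = (\<Sum>x\<in>W. 1 - of_bool ({v, x} \<in> E))"
      by (intro sum.cong) (auto simp: insert_commute)
    also have "\<dots> = m - d v"
      by (simp add: sum_subtractf d edge_sum_def m_def)
    finally show "(\<Sum>x\<in>W. of_bool ({x, v} \<notin> E) * d v) = (m - d v) * d v"
      by (simp add: sum_distrib_right[symmetric])
  qed
  also have "\<dots> = m * M - (\<Sum>v\<in>W. (d v)\<^sup>2)"
    by (simp add: left_diff_distrib sum_subtractf sum_distrib_left[symmetric] sum_d power2_eq_square)
  finally have nonnbrs: "(\<Sum>x\<in>W. edge_sum E (W - N x) W) = m * M - (\<Sum>v\<in>W. (d v)\<^sup>2)" .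
  have "(\<Sum>x\<in>W. (real k + 1) * (M + mono_sum E (c x) W))
      \<le> (\<Sum>x\<in>W. (real k + 1) * (2 * edge_sum E (W - N x) W) + k * (d x)\<^sup>2)"
    by (intro sum_mono bound)
  also have "\<dots> = (real k + 1) * 2 * (\<Sum>x\<in>W. edge_sum E (W - N x) W) + k * (\<Sum>x\<in>W. (d x)\<^sup>2)"
    by (simp add: sum.distrib sum_distrib_left algebra_simps)
  \<comment> \<open>The squared degrees have coefficient -2(k+1) from the non-neighbours and +k from
    the neighbourhoods, in total -(k+2).\<close>
  also have "\<dots> = 2 * (real k + 1) * m * M - (real k + 2) * (\<Sum>x\<in>W. (d x)\<^sup>2)"
    unfolding nonnbrs by (simp add: algebra_simps)
  finally obtain x where x: "x \<in> W" and le: "m * ((real k + 1) * (M + mono_sum E (c x) W))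
      \<le> 2 * (real k + 1) * m * M - (real k + 2) * (\<Sum>x\<in>W. (d x)\<^sup>2)"
    using exists_le_average[OF W] unfolding m_def by blast
  \<comment> \<open>Cauchy-Schwarz makes the bound depend on the degrees only through their sum
    \<open>M\<close>.\<close>
  have "M\<^sup>2 \<le> m * (\<Sum>x\<in>W. (d x)\<^sup>2)"
    using sum_squared_le_sum_of_squares[of d W] by (simp add: sum_d m_def mult.commute)
  then have "(real k + 2) * M\<^sup>2 \<le> (real k + 2) * (m * (\<Sum>x\<in>W. (d x)\<^sup>2))"
    by (intro mult_left_mono) auto
  moreover have "m * (m * ((real k + 1) * (M + mono_sum E (c x) W)))
      \<le> m * (2 * (real k + 1) * m * M - (real k + 2) * (\<Sum>x\<in>W. (d x)\<^sup>2))"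
    using le by (intro mult_left_mono) (auto simp: m_def)
  ultimately have "(real k + 1) * m\<^sup>2 * mono_sum E (c x) W + (real k + 2) * M\<^sup>2
      \<le> (real k + 1) * m\<^sup>2 * M"
    by (simp add: algebra_simps power2_eq_square)
  moreover have "c x ` W \<subseteq> {..Suc k}"
    using g[OF x] by (force simp: c_def)
  ultimately show ?thesis
    unfolding m_def M_def by (intro exI[of _ "c x"]) simp
qed

section \<open>Induction on the number of colours\<close>

text \<open>Turns the induction hypothesis into the form that \<open>coloring_step\<close> expects.
  With q = k m^2, multiplying the first assumption by k+1 and adding q(k+1)M bounds q(k+1)(M+X) by
  q^2 - (q - (k+1)M)^2.\<close>

lemma uniform_bound_of_edge_bound:
  fixes k :: nat and m M X :: real
  assumes "k * m\<^sup>2 * X + (real k + 1) * M\<^sup>2 \<le> k * m\<^sup>2 * M" "X \<le> M"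
  shows "(real k + 1) * (M + X) \<le> k * m\<^sup>2"
proof (cases "k * m\<^sup>2 = 0")
  case True
  then have "(real k + 1) * M\<^sup>2 \<le> 0" using assms(1) by auto
  then have "M = 0" by (simp add: mult_le_0_iff)
  with True assms(2) show ?thesis by (simp add: mult_nonneg_nonpos del: mult_eq_0_iff)
next
  case False
  define q where "q = k * m\<^sup>2"
  have q: "q > 0" using False by (simp add: q_def zero_less_mult_iff)
  have "(real k + 1) * (q * X + (real k + 1) * M\<^sup>2) \<le> (real k + 1) * (q * M)"
    using assms(1) by (intro mult_left_mono) (auto simp: q_def)
  moreover have "0 \<le> (q - (real k + 1) * M)\<^sup>2" by simp
  ultimately have "q * ((real k + 1) * (M + X)) \<le> q * q"
    by (simp add: power2_eq_square algebra_simps)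
  with q have "(real k + 1) * (M + X) \<le> q" by (simp only: mult_le_cancel_left_pos)
  then show ?thesis by (simp only: q_def)
qed

text \<open>A stability form of Turan's theorem: as \<open>mono_sum\<close> is nonnegative, it
  forces M \<le> k n^2/(k+1) for k > 0, where M is the edge sum and n the order of \<open>W\<close>,
  and at equality the colouring is proper. Being free of division, it also covers k = 0, where it
  says that there are no edges.\<close>

theorem K_free_coloring:
  fixes E :: "'a set set"
  assumes "\<And>u. {u} \<notin> E" "finite W" "K_free (k + 2) W E"
  shows "\<exists>c :: 'a \<Rightarrow> nat. c ` W \<subseteq> {..k} \<and>
    k * (card W)\<^sup>2 * mono_sum E c W + (real k + 1) * (edge_sum E W W)\<^sup>2
      \<le> k * (card W)\<^sup>2 * edge_sum E W W"
  using assms(2,3)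
proof (induction k arbitrary: W)
  case 0
  then show ?case
    using K_free_2_edge_sum[of W E] assms(1) by (intro exI[of _ "\<lambda>_. 0"]) (auto simp: numeral_2_eq_2)
next
  case (Suc k)
  show ?case
  proof (cases "W = {}")
    case True
    then show ?thesis by (simp add: edge_sum_def mono_sum_def)
  next
    case False
    let ?N = "\<lambda>x. {v \<in> W. {x, v} \<in> E}"
    let ?Q = "\<lambda>x (c :: 'a \<Rightarrow> nat). c ` ?N x \<subseteq> {..k} \<and>
      (real k + 1) * (edge_sum E (?N x) (?N x) + mono_sum E c (?N x)) \<le> k * (real (card (?N x)))\<^sup>2"
    have "\<forall>x\<in>W. \<exists>c. ?Q x c"
    proof
      fix x assume "x \<in> W"
      have fin: "finite (?N x)" using Suc.prems(1) by simp
      have "K_free (k + 2) (?N x) E"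
        using K_free_neighbours[of "k + 2" W E x] Suc.prems(2) assms(1) \<open>x \<in> W\<close> by simp
      from Suc.IH[OF fin this] obtain c :: "'a \<Rightarrow> nat" where c: "c ` ?N x \<subseteq> {..k}"
        "k * (card (?N x))\<^sup>2 * mono_sum E c (?N x) + (real k + 1) * (edge_sum E (?N x) (?N x))\<^sup>2
          \<le> k * (card (?N x))\<^sup>2 * edge_sum E (?N x) (?N x)"
        by blast
      then show "\<exists>c. ?Q x c"
        by (intro exI[of _ c] conjI uniform_bound_of_edge_bound mono_sum_le_edge_sum)
          (simp_all only: of_nat_power of_nat_mult)
    qed
    from bchoice[OF this] obtain g where g: "\<And>x. x \<in> W \<Longrightarrow> ?Q x (g x)"
      by (elim exE) (rule that, erule bspec)
    have "g x v \<le> k" if "x \<in> W" "v \<in> ?N x" for x v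
      using g[OF that(1)] that(2) by blast
    moreover have "(real k + 1) * (edge_sum E (?N x) (?N x) + mono_sum E (g x) (?N x))
        \<le> k * (real (card (?N x)))\<^sup>2" if "x \<in> W" for x
      using g[OF that] by blast
    ultimately have "\<exists>c. c ` W \<subseteq> {..Suc k} \<and>
      (real k + 1) * (card W)\<^sup>2 * mono_sum E c W + (real k + 2) * (edge_sum E W W)\<^sup>2
        \<le> (real k + 1) * (card W)\<^sup>2 * edge_sum E W W"
      by (rule coloring_step[OF Suc.prems(1) False])
    then show ?thesis by (simp add: algebra_simps)
  qed
qed

section \<open>Merging four colours into two\<close>

text \<open>Four colours split into two pairs in three ways. An edge with two different colours
  becomes monochromatic in exactly one of them, a monochromatic edge stays so in all three; the best
  split is at most the mean.\<close>

lemma bipartition_of_four_coloring: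
  fixes c :: "'a \<Rightarrow> nat"
  assumes "c ` W \<subseteq> {..3}"
  shows "\<exists>s :: 'a \<Rightarrow> bool. 3 * mono_sum E s W \<le> edge_sum E W W + 2 * mono_sum E c W"
proof -
  \<comment> \<open>For i = 1, 2, 3 this pairs colour i with colour 0 against the other two.\<close>
  define s where "s = (\<lambda>i v. c v = 0 \<or> c v = i)"
  have pt: "(of_bool (A \<and> s 1 u = s 1 v) + of_bool (A \<and> s 2 u = s 2 v)
      + of_bool (A \<and> s 3 u = s 3 v) :: real) = of_bool A + 2 * of_bool (A \<and> c u = c v)"
    if "u \<in> W" "v \<in> W" for A u v
  proof -
    have "c u \<in> {0, 1, 2, 3}" "c v \<in> {0, 1, 2, 3}"
      using assms that by force+
    then show ?thesis
      unfolding s_def by (cases A) (elim insertE emptyE; simp)+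
  qed
  have "mono_sum E (s 1) W + mono_sum E (s 2) W + mono_sum E (s 3) W
      = edge_sum E W W + 2 * mono_sum E c W"
    unfolding mono_sum_def edge_sum_def sum.distrib[symmetric] sum_distrib_left
    by (intro sum.cong refl pt)
  then have "3 * mono_sum E (s 1) W \<le> edge_sum E W W + 2 * mono_sum E c W \<or>
      3 * mono_sum E (s 2) W \<le> edge_sum E W W + 2 * mono_sum E c W \<or>
      3 * mono_sum E (s 3) W \<le> edge_sum E W W + 2 * mono_sum E c W"
    by linarith
  then show ?thesis by blast
qed

section \<open>From ordered-pair sums to edge deletion\<close>

lemma twice_card_le_card_ordered_pairs:
  assumes "finite V" "F \<subseteq> nsets V 2"
  shows "2 * card F \<le> card {(u, v). u \<in> V \<and> v \<in> V \<and> {u, v} \<in> F}"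
proof -
  let ?P = "\<lambda>e. {(u, v). {u, v} = e}"
  have P: "card (?P e) = 2" if "e \<in> F" for e
  proof -
    have "card e = 2" using assms(2) that by (auto simp: nsets_def)
    then obtain u v where "e = {u, v}" "u \<noteq> v"
      unfolding card_2_iff by blast
    then have "?P e = {(u, v), (v, u)}" by (auto simp: doubleton_eq_iff)
    with \<open>u \<noteq> v\<close> show ?thesis by simp
  qed
  have "finite F" using assms finite_imp_finite_nsets finite_subset by blast
  moreover have "finite (?P e)" if "e \<in> F" for e
    \<comment> \<open>An infinite set has cardinality 0, so cardinality 2 already gives
      finiteness.\<close>
    by (rule card_ge_0_finite) (use P[OF that] in simp)
  ultimately have "card (\<Union>e\<in>F. ?P e) = (\<Sum>e\<in>F. card (?P e))"
    by (intro card_UN_disjoint) auto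
  also have "\<dots> = (\<Sum>e\<in>F. 2)" by (intro sum.cong refl P)
  finally have "2 * card F = card (\<Union>e\<in>F. ?P e)" by simp
  also have "\<dots> \<le> card {(u, v). u \<in> V \<and> v \<in> V \<and> {u, v} \<in> F}"
  proof (rule card_mono)
    show "finite {(u, v). u \<in> V \<and> v \<in> V \<and> {u, v} \<in> F}"
      using assms(1) by (rule_tac finite_subset[of _ "V \<times> V"]) auto
    show "(\<Union>e\<in>F. ?P e) \<subseteq> {(u, v). u \<in> V \<and> v \<in> V \<and> {u, v} \<in> F}"
      using assms(2) by (auto simp: nsets_def)
  qed
  finally show ?thesis .
qed

text \<open>Deleting the edges on which \<open>s\<close> is constant leaves the two classes of
  \<open>s\<close> as a bipartition; the factor 2 accounts for ordered pairs.\<close>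

lemma tau_B_le_mono_sum:
  fixes s :: "'a \<Rightarrow> bool"
  assumes "finite_simple_graph V E"
  shows "2 * real (tau_B V E) \<le> mono_sum E s V"
proof -
  define F where "F = {e \<in> E. \<forall>u\<in>e. \<forall>v\<in>e. s u = s v}"
  have F: "{u, v} \<in> F \<longleftrightarrow> {u, v} \<in> E \<and> s u = s v" for u v
    by (auto simp: F_def)
  have V: "finite V" "E \<subseteq> nsets V 2"
    using assms by (auto simp: finite_simple_graph_def)
  have "\<exists>x\<in>{v \<in> V. s v}. \<exists>y\<in>{v \<in> V. \<not> s v}. e = {x, y}" if "e \<in> E - F" for e
  proof -
    have "card e = 2" "e \<subseteq> V" using V(2) that by (auto simp: nsets_def)
    then obtain u v where e: "e = {u, v}" "u \<in> V" "v \<in> V"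
      unfolding card_2_iff by blast
    then have "s u \<noteq> s v" using that by (auto simp: F_def)
    with e show ?thesis by (cases "s u") auto
  qed
  then have "bipartite_graph V (E - F)"
    unfolding bipartite_graph_def
    by (intro exI[of _ "{v \<in> V. s v}"] exI[of _ "{v \<in> V. \<not> s v}"]) auto
  then have "tau_B V E \<le> card F"
    by (intro tau_B_attained(2)[OF assms]) (auto simp: F_def)
  also have "2 * card F \<le> card {(u, v). u \<in> V \<and> v \<in> V \<and> {u, v} \<in> F}"
    using V by (intro twice_card_le_card_ordered_pairs) (auto simp: F_def)
  finally have "2 * tau_B V E \<le> card {(u, v). u \<in> V \<and> v \<in> V \<and> {u, v} \<in> F}"
    by simp
  also have "{(u, v). u \<in> V \<and> v \<in> V \<and> {u, v} \<in> F}
      = (V \<times> V) \<inter> {p. {fst p, snd p} \<in> E \<and> s (fst p) = s (snd p)}"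
    using F by auto
  finally have "2 * tau_B V E \<le> card ((V \<times> V) \<inter> {p. {fst p, snd p} \<in> E \<and> s (fst p) = s (snd p)})" .
  moreover have "real (card ((V \<times> V) \<inter> {p. {fst p, snd p} \<in> E \<and> s (fst p) = s (snd p)}))
      = mono_sum E s V"
    using V(1) unfolding mono_sum_def sum.cartesian_product
    by (simp add: of_bool_def sum.If_cases case_prod_beta)
  ultimately show ?thesis by linarith
qed

theorem theorem4p8:
  fixes V :: "'a set" and E :: "'a set set" and n :: nat
  assumes "finite_simple_graph V E"
    and "card V = n"
    and "K_free 5 V E"
  shows "real (tau_B V E) \<le> 29 * (real n)\<^sup>2 / 200"
proof -
  have V: "finite V" "\<And>u. {u} \<notin> E"
    using assms(1) by (auto simp: finite_simple_graph_def nsets_def)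
  define M where "M = edge_sum E V V"
  define q where "q = (real n)\<^sup>2"
  define t where "t = real (tau_B V E)"
  obtain c :: "'a \<Rightarrow> nat" where c: "c ` V \<subseteq> {..3}"
    and mono: "3 * q * mono_sum E c V + 4 * M\<^sup>2 \<le> 3 * q * M"
    using K_free_coloring[OF V(2,1), of 3] assms(2,3) unfolding M_def q_def by auto
  obtain s :: "'a \<Rightarrow> bool" where "3 * mono_sum E s V \<le> M + 2 * mono_sum E c V"
    using bipartition_of_four_coloring[OF c] unfolding M_def by blast
  with tau_B_le_mono_sum[OF assms(1), of s] have t: "6 * t \<le> M + 2 * mono_sum E c V"
    by (simp add: t_def)
  have "t \<le> 9 / 64 * q"
  proof (cases "q = 0")
    case True
    with mono have "M = 0" by simp
    with t mono_sum_le_edge_sum[of E c V] True show ?thesis by (simp add: M_def)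
  next
    case False
    then have q: "q > 0" by (simp add: q_def)
    then have "q * (6 * t) \<le> q * (M + 2 * mono_sum E c V)"
      using t by (intro mult_left_mono) auto
    \<comment> \<open>Eliminating the monochromatic edges gives 6qt \<le> 3qM - 8M^2/3. The right
      side is largest at M = 9q/16, with value 27q^2/32, and the square certifies this
      maximum.\<close>
    moreover have "0 \<le> (M - 9 / 16 * q)\<^sup>2" by simp
    ultimately have "q * t \<le> q * (9 / 64 * q)"
      using mono by (simp add: power2_eq_square algebra_simps)
    with q show ?thesis by simp
  qed
  moreover have "q \<ge> 0" by (simp add: q_def)
  ultimately show ?thesis
    unfolding t_def[symmetric] q_def[symmetric] by simp
qed

end
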